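(* Let $f:[0,\infty)\to[0,\infty)$ be concave with $f(0)=0$. Then for any nonnegative random variable $X$, with $b=b(p)$ and $\zeta_b$ the moment ratio of $X$ and the associated function defined in the context, $$f\left(\mathbb{E}[X]\right)\;\geq\;\mathbb{E}\left[f(X)\right]\;\geq\;\sup_{a>b} f\left(a\,\mathbb{E}[X]\right)\zeta_b(a).$$
   Context: For the random variable $X$, let $b=b(p):=\mathbb{E}[X^p]/\mathbb{E}[X]^p\geq 1$ be the ratio of the $p$-th non-centralized moment to the $p$-th power of the first moment. For real $t$ write $[t]^+:=\max\{t,0\}$. Define $$\zeta_b(a):=\sup_{\frac1p+\frac1q=1}\frac{\left[1-b(p)^{1/p}a^{-1/q}\right]^+}{a},$$ where the supremum is over $0<p,q<\infty$ with $\frac1p+\frac1q=1$. The case $b=\infty$ yields a trivial lower bound. *)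

theory Defs
  imports "HOL-Probability.Probability"
begin

text \<open>
  For a nonnegative random variable \<open>X\<close>, the expectation of \<open>X\<close> to the power \<open>p\<close>
  divided by the \<open>p\<close>-th power of the expectation of \<open>X\<close>; the value is infinite when
  the \<open>p\<close>-th moment is.  In the degenerate case that \<open>X\<close> vanishes almost surely
  the quotient \<open>0 / 0\<close> is read as \<open>0\<close>.
\<close>

definition moment_ratio :: "'a measure \<Rightarrow> ('a \<Rightarrow> real) \<Rightarrow> real \<Rightarrow> ennreal" where
  "moment_ratio M X p =
     (\<integral>\<^sup>+ \<omega>. ennreal (X \<omega> powr p) \<partial>M) / ennreal ((\<integral>\<omega>. X \<omega> \<partial>M) powr p)"

text \<open>Real powers on \<open>[0, \<infinity>]\<close>, meant for positive exponents.\<close>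

definition ennreal_powr :: "ennreal \<Rightarrow> real \<Rightarrow> ennreal" where
  "ennreal_powr x r = (if x = \<infinity> then \<infinity> else ennreal (enn2real x powr r))"

text \<open>
  Subtraction on \<open>ennreal\<close> is truncated at \<open>0\<close> (and \<open>1 - \<infinity> = 0\<close>), so the numerator is
  the positive part of \<open>1 - b(p)\<^sup>1\<^sup>/\<^sup>p a\<^sup>-\<^sup>1\<^sup>/\<^sup>q\<close>.  The constraints force \<open>p > 1\<close> and \<open>q > 1\<close>.
\<close>

definition zeta :: "(real \<Rightarrow> ennreal) \<Rightarrow> real \<Rightarrow> ennreal" where
  "zeta b a =
     (SUP (p, q) \<in> {(p, q). 0 < p \<and> 0 < q \<and> 1 / p + 1 / q = 1}.
        (1 - ennreal_powr (b p) (1 / p) * ennreal (a powr (- (1 / q)))) / ennreal a)"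

end

theory Submission
  imports Defs
begin

text \<open>
  The upper bound is Jensen's inequality, obtained by integrating a supporting line of \<open>f\<close>.
  For the lower bound put \<open>t = a E[X]\<close>.  Concavity and \<open>f 0 = 0\<close> give
  \<open>f x \<ge> f t / t * x\<close> for \<open>x \<le> t\<close>, while \<open>x \<le> x\<^sup>p t\<^sup>1\<^sup>-\<^sup>p\<close> for \<open>x \<ge> t\<close>, so that
  \<open>f x \<ge> f t / t * (x - x\<^sup>p t\<^sup>1\<^sup>-\<^sup>p)\<close> for all \<open>x \<ge> 0\<close>.  Taking expectations yields
  \<open>E[f(X)] \<ge> f t / a * (1 - r\<^sup>p)\<close> with \<open>r = b(p)\<^sup>1\<^sup>/\<^sup>p a\<^sup>-\<^sup>1\<^sup>/\<^sup>q\<close>, and \<open>r\<^sup>p \<le> r\<close>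
  whenever \<open>r \<le> 1\<close>; this replaces the use of Hoelder's and Markov's inequalities.
\<close>

lemma nn_integral_eq_0_of_integral_eq_0:
  fixes X :: "'a \<Rightarrow> real"
  assumes X: "integrable M X" and X0: "\<And>\<omega>. \<omega> \<in> space M \<Longrightarrow> 0 \<le> X \<omega>"
    and "(\<integral>\<omega>. X \<omega> \<partial>M) = 0" and "f 0 = 0"
  shows "(\<integral>\<^sup>+ \<omega>. ennreal (f (X \<omega>)) \<partial>M) = 0"
proof -
  have "AE \<omega> in M. X \<omega> = 0"
    using assms integral_nonneg_eq_0_iff_AE[OF X] by auto
  then have "(\<integral>\<^sup>+ \<omega>. ennreal (f (X \<omega>)) \<partial>M) = (\<integral>\<^sup>+ \<omega>. 0 \<partial>M)"
    by (intro nn_integral_cong_AE) (auto simp: \<open>f 0 = 0\<close>)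
  then show ?thesis by simp
qed

lemma concave_on_supporting_line:
  fixes f :: "real \<Rightarrow> real"
  assumes "concave_on S f" and "m \<in> interior S"
  obtains c where "\<And>x. x \<in> S \<Longrightarrow> f x \<le> f m + c * (x - m)"
proof -
  \<comment> \<open>The right derivative at \<open>m\<close> of the convex function
    \<open>- f\<close>, taken as the infimum of its difference quotients over points of
    \<open>S\<close> to the right of \<open>m\<close>.\<close>
  define d where "d = Inf ((\<lambda>t. (- f m - - f t) / (m - t)) ` ({m<..} \<inter> S))"
  have line: "- f x \<ge> - f m + d * (x - m)" if "x \<in> S" for x
    unfolding d_def
    using convex_le_Inf_differential[of S "\<lambda>x. - f x" m x] assms that
    by (simp add: concave_on_def)
  show thesis
  proof (rule that)
    show "f x \<le> f m + - d * (x - m)" if "x \<in> S" for x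
      using line[OF that] by simp
  qed
qed

lemma (in prob_space) concave_nn_integral_le:
  fixes f :: "real \<Rightarrow> real"
  assumes X: "integrable M X" and X0: "\<And>\<omega>. \<omega> \<in> space M \<Longrightarrow> 0 \<le> X \<omega>"
    and f: "concave_on {0..} f" and f0: "\<And>x. 0 \<le> x \<Longrightarrow> 0 \<le> f x"
    and pos: "0 < expectation X"
  shows "(\<integral>\<^sup>+ \<omega>. ennreal (f (X \<omega>)) \<partial>M) \<le> ennreal (f (expectation X))"
proof -
  let ?m = "expectation X"
  \<comment> \<open>Positivity of the expectation matters here: at the endpoint 0 a supporting line
    may fail to exist, as for the square root.\<close>
  have "?m \<in> interior {0..}" using pos by simp
  then obtain c where c: "\<And>x. 0 \<le> x \<Longrightarrow> f x \<le> f ?m + c * (x - ?m)"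
    using concave_on_supporting_line[OF f] by (metis atLeast_iff)
  let ?L = "\<lambda>\<omega>. f ?m + c * (X \<omega> - ?m)"
  have "(\<integral>\<^sup>+ \<omega>. ennreal (f (X \<omega>)) \<partial>M) \<le> (\<integral>\<^sup>+ \<omega>. ennreal (?L \<omega>) \<partial>M)"
    by (intro nn_integral_mono ennreal_leI c X0)
  \<comment> \<open>\<open>?L\<close> dominates \<open>f (X \<omega>)\<close>, which is nonnegative,
    so its nonnegative integral is its expectation.\<close>
  also have "\<dots> = ennreal (expectation ?L)"
    using X by (intro nn_integral_eq_integral AE_I2 order_trans[OF f0 c] X0) auto
  also have "expectation ?L = f ?m"
    using X by (simp add: prob_space)
  finally show ?thesis .
qed

lemma concave_on_ge_moment_bound:
  fixes f :: "real \<Rightarrow> real"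
  assumes f: "concave_on {0..} f" and f0: "\<And>x. 0 \<le> x \<Longrightarrow> 0 \<le> f x"
    and "f 0 = 0" and t: "0 < t" and p: "1 < p" and x: "0 \<le> x"
  shows "f t / t * (x - t powr (1 - p) * x powr p) \<le> f x"
proof (cases "x \<le> t")
  case True
  have "f ((1 - x / t) *\<^sub>R 0 + (x / t) *\<^sub>R t) \<ge> (1 - x / t) * f 0 + (x / t) * f t"
    using True t x by (intro concave_onD[OF f]) auto
  then have "f t / t * x \<le> f x" using \<open>f 0 = 0\<close> t by (simp add: mult.commute)
  moreover have "f t / t * (x - t powr (1 - p) * x powr p) \<le> f t / t * x"
    using f0[of t] t by (intro mult_left_mono) auto
  ultimately show ?thesis by linarith
next
  case False
  have "x = x powr (1 - p) * x powr p"
    using False t by (simp flip: powr_add)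
  \<comment> \<open>The exponent \<open>1 - p\<close> is negative and \<open>t < x\<close>.\<close>
  also have "\<dots> \<le> t powr (1 - p) * x powr p"
    using False t p by (intro mult_right_mono powr_mono2') auto
  finally have "f t / t * (x - t powr (1 - p) * x powr p) \<le> 0"
    using f0[of t] t by (intro mult_nonneg_nonpos) auto
  then show ?thesis using f0[OF x] by linarith
qed

text \<open>\<open>g\<close> may be negative, where \<open>ennreal\<close> clips it to 0; the
  positive part of \<open>g\<close> mediates between the two integrals.\<close>

lemma ennreal_integral_le_nn_integral:
  fixes g h :: "'a \<Rightarrow> real"
  assumes g: "integrable M g"
    and h: "\<And>\<omega>. \<omega> \<in> space M \<Longrightarrow> g \<omega> \<le> h \<omega>"
  shows "ennreal (\<integral>\<omega>. g \<omega> \<partial>M) \<le> (\<integral>\<^sup>+ \<omega>. ennreal (h \<omega>) \<partial>M)"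
proof -
  have "ennreal (\<integral>\<omega>. g \<omega> \<partial>M) \<le> ennreal (\<integral>\<omega>. max 0 (g \<omega>) \<partial>M)"
    using g by (intro ennreal_leI integral_mono) auto
  also have "\<dots> = (\<integral>\<^sup>+ \<omega>. ennreal (max 0 (g \<omega>)) \<partial>M)"
    using g by (intro nn_integral_eq_integral[symmetric]) auto
  also have "\<dots> \<le> (\<integral>\<^sup>+ \<omega>. ennreal (h \<omega>) \<partial>M)"
    using h by (intro nn_integral_mono) (simp add: ennreal_leI max_def ennreal_neg)
  finally show ?thesis .
qed

lemma concave_nn_integral_ge:
  fixes f :: "real \<Rightarrow> real" and X :: "'a \<Rightarrow> real"
  assumes X: "integrable M X" and X0: "\<And>\<omega>. \<omega> \<in> space M \<Longrightarrow> 0 \<le> X \<omega>"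
    and f: "concave_on {0..} f" and f0: "\<And>x. 0 \<le> x \<Longrightarrow> 0 \<le> f x" and f00: "f 0 = 0"
    and pos: "0 < (\<integral>\<omega>. X \<omega> \<partial>M)" and a: "0 < a"
    and pq: "0 < p" "0 < q" "1 / p + 1 / q = 1"
  shows "ennreal (f (a * (\<integral>\<omega>. X \<omega> \<partial>M))) *
      ((1 - ennreal_powr (moment_ratio M X p) (1 / p) * ennreal (a powr (- (1 / q)))) / ennreal a)
    \<le> (\<integral>\<^sup>+ \<omega>. ennreal (f (X \<omega>)) \<partial>M)"
proof (cases "(\<integral>\<^sup>+ \<omega>. ennreal (X \<omega> powr p) \<partial>M) = \<infinity>")
  \<comment> \<open>An infinite \<open>p\<close>-th moment makes the truncated difference, and with
    it the left side, 0.\<close>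
  case True
  then have "moment_ratio M X p = \<infinity>"
    by (simp add: moment_ratio_def ennreal_top_divide)
  then show ?thesis
    using a by (simp add: ennreal_powr_def ennreal_top_mult diff_eq_0_ennreal)
next
  case False
  define m where "m = (\<integral>\<omega>. X \<omega> \<partial>M)"
  define e where "e = (\<integral>\<omega>. X \<omega> powr p \<partial>M)"
  define b where "b = e / m powr p"
  define r where "r = b powr (1 / p) * a powr (- (1 / q))"
  have m: "0 < m" using pos by (simp add: m_def)
  have "1 / p < 1" using pq by (smt (verit) divide_pos_pos)
  then have p: "1 < p" using pq by (simp add: field_simps)
  have Xm: "X \<in> borel_measurable M" using X by auto
  have Xp: "integrable M (\<lambda>\<omega>. X \<omega> powr p)"
    using False Xm by (intro integrableI_nonneg) (auto simp: top.not_eq_extremum)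
  have e0: "0 \<le> e" unfolding e_def by simp
  have b0: "0 \<le> b" using e0 by (simp add: b_def)
  have "(\<integral>\<^sup>+ \<omega>. ennreal (X \<omega> powr p) \<partial>M) = ennreal e"
    unfolding e_def using Xp by (intro nn_integral_eq_integral) auto
  then have mr: "moment_ratio M X p = ennreal b"
    using e0 m by (simp add: moment_ratio_def m_def[symmetric] b_def divide_ennreal)
  have r0: "0 \<le> r" by (simp add: r_def)
  have "ennreal_powr (moment_ratio M X p) (1 / p) * ennreal (a powr (- (1 / q))) = ennreal r"
    using b0 by (simp add: mr ennreal_powr_def r_def ennreal_mult')
  then have lhs: "ennreal (f (a * m)) *
      ((1 - ennreal_powr (moment_ratio M X p) (1 / p) * ennreal (a powr (- (1 / q)))) / ennreal a)
      = ennreal (f (a * m)) * (ennreal (1 - r) / ennreal a)"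
    using r0 by (simp flip: ennreal_1 add: ennreal_minus)
  show ?thesis
  proof (cases "r \<le> 1")
    case False
    then show ?thesis unfolding lhs[unfolded m_def] by (simp add: ennreal_neg)
  next
    case True
    define t where "t = a * m"
    have t: "0 < t" using a m by (simp add: t_def)
    \<comment> \<open>Conjugacy of the exponents turns the power of \<open>a\<close> in
      \<open>r powr p\<close> into \<open>a powr (1 - p)\<close>.\<close>
    have q: "1 / q * p = p - 1" using pq p by (simp add: field_simps)
    have rp: "r powr p = b * a powr (1 - p)"
      using p b0 q by (simp add: r_def powr_mult powr_powr)
    have "r powr p \<le> r"
    proof (cases "r = 0")
      case False
      then have "r powr p \<le> r powr 1"
        using True r0 p by (intro powr_mono') auto
      then show ?thesis using r0 by simp
    qed simp
    then have "f t / a * (1 - r) \<le> f t / a * (1 - r powr p)"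
      using f0[of t] t a by (intro mult_left_mono) auto
    \<comment> \<open>Both sides equal \<open>m * b * a powr (1 - p)\<close>, because
      \<open>e = b * m powr p\<close> and \<open>t = a * m\<close>.\<close>
    also have "t powr (1 - p) * e = m * r powr p"
      using a m e0 by (simp add: t_def rp b_def powr_mult powr_diff mult_ac)
    then have "f t / a * (1 - r powr p) = f t / t * (m - t powr (1 - p) * e)"
      using a m by (simp add: t_def field_simps)
    also have "\<dots> = (\<integral>\<omega>. f t / t * (X \<omega> - t powr (1 - p) * X \<omega> powr p) \<partial>M)"
      using X Xp by (simp add: m_def e_def)
    finally have "ennreal (f t / a * (1 - r)) \<le> ennreal \<dots>"
      by (rule ennreal_leI)
    also have "\<dots> \<le> (\<integral>\<^sup>+ \<omega>. ennreal (f (X \<omega>)) \<partial>M)"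
      using X Xp X0 concave_on_ge_moment_bound[OF f f0 f00 t p]
      by (intro ennreal_integral_le_nn_integral) auto
    finally have "ennreal (f t / a * (1 - r)) \<le> (\<integral>\<^sup>+ \<omega>. ennreal (f (X \<omega>)) \<partial>M)" .
    moreover have "ennreal (f t) * (ennreal (1 - r) / ennreal a) = ennreal (f t / a * (1 - r))"
      using True a t f0[of t] by (simp add: divide_ennreal flip: ennreal_mult)
    ultimately show ?thesis using lhs by (simp add: m_def t_def)
  qed
qed

theorem lemma1:
  fixes M :: "'a measure" and X :: "'a \<Rightarrow> real" and f :: "real \<Rightarrow> real"
  assumes "prob_space M"
    and "integrable M X"
    and "\<And>\<omega>. \<omega> \<in> space M \<Longrightarrow> 0 \<le> X \<omega>"
    and "concave_on {0..} f"
    and "\<And>x. 0 \<le> x \<Longrightarrow> 0 \<le> f x"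
    and "f 0 = 0"
  shows "ennreal (f (\<integral>\<omega>. X \<omega> \<partial>M)) \<ge> (\<integral>\<^sup>+ \<omega>. ennreal (f (X \<omega>)) \<partial>M)
    \<and> (\<forall>p>1. (\<integral>\<^sup>+ \<omega>. ennreal (f (X \<omega>)) \<partial>M) \<ge>
         (SUP a \<in> {a. ennreal a > moment_ratio M X p}.
            ennreal (f (a * (\<integral>\<omega>. X \<omega> \<partial>M))) * zeta (moment_ratio M X) a))"
proof (cases "(\<integral>\<omega>. X \<omega> \<partial>M) = 0")
  \<comment> \<open>\<open>X\<close> vanishes almost everywhere, and each term of the supremum
    contains the factor \<open>f (a * 0) = 0\<close>.\<close>
  case True
  then show ?thesis
    using nn_integral_eq_0_of_integral_eq_0[of M X f] assms
    by (intro conjI allI impI SUP_least) simp_all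
next
  case False
  have "0 \<le> (\<integral>\<omega>. X \<omega> \<partial>M)"
    using assms(3) by (intro integral_nonneg_AE) auto
  with False have pos: "0 < (\<integral>\<omega>. X \<omega> \<partial>M)" by simp
  have "ennreal (f (a * (\<integral>\<omega>. X \<omega> \<partial>M))) * zeta (moment_ratio M X) a
      \<le> (\<integral>\<^sup>+ \<omega>. ennreal (f (X \<omega>)) \<partial>M)" if "moment_ratio M X p < ennreal a" for a p
  proof -
    \<comment> \<open>The moment ratio is at least 0, so \<open>a\<close> is positive. The factor
      \<open>f (a * E[X])\<close> then moves inside the supremum defining \<open>zeta\<close>, which
      leaves one bound per conjugate pair.\<close>
    have "0 < ennreal a" using that by (rule le_less_trans[OF zero_le])
    then have "0 < a" by simp
    then show ?thesis
      unfolding zeta_def SUP_mult_left_ennreal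
      by (intro SUP_least)
        (auto intro!: concave_nn_integral_ge[OF assms(2,3,4,5,6) pos])
  qed
  then show ?thesis
    using prob_space.concave_nn_integral_le[OF assms(1-5) pos] by (auto intro!: SUP_least)
qed

end
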